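(* Let $\alpha=(\alpha_1,\dots,\alpha_s)\in\mathbb{Z}^s$ with $\alpha_i\cdot\alpha_{i+1}<0$ for all $1\le i\le s-1$, $\alpha_1\ge 0$, and $s$ even if $s\ne 1$. Let $T$ be a tournament of order $n=\sum_{i=1}^s|\alpha_i|$. Then $$g_T(\alpha)=g_T(-\alpha),$$ where $-\alpha=(-\alpha_1,\dots,-\alpha_s)$ and $g_T(\gamma)$ denotes the number of oriented (here necessarily Hamiltonian) cycles of $T$ of type $C(\gamma)$.
   Context: A tournament is an orientation of a finite complete graph. An oriented cycle $C=v_1v_2\dots v_m$ ($m\ge 3$) in a tournament $T$ consists of distinct vertices $v_1,\dots,v_m$ together with the arcs of $T$ joining consecutive vertices and the arc joining $v_m$ and $v_1$; cycles are identified with their arc sets. A block is a maximal directed subpath (a directed cycle, also called a circuit, is regarded as having a single block). Let $\alpha=(\alpha_1,\dots,\alpha_s)$ be a tuple of nonzero integers with alternating signs, with $s=1$ or $s$ even. The cycle $C$ is of type $C(\alpha)$ if it has $\sum|\alpha_i|$ vertices and, for some starting vertex and some sense of traversal, one meets successively exactly $s$ blocks $I_1,\dots,I_s$ (the traversal starting at the beginning of $I_1$), with $I_i$ of length $|\alpha_i|$ and directed in the sense of the traversal iff $\alpha_i>0$. For $s=1$, both types $C(m)$ and $C(-m)$ are the directed cycles of length $m$. $g_T(\alpha)$ is the number of cycles in $T$ of type $C(\alpha)$, each cycle counted once. *)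

theory Defs
  imports "Graph_Theory.Graph_Theory"
begin

locale tournament = pair_digraph T for T :: "'a pair_pre_digraph" +
  assumes exactly_one_arc:
    "\<lbrakk>u \<in> pverts T; v \<in> pverts T; u \<noteq> v\<rbrakk> \<Longrightarrow> (u, v) \<in> parcs T \<longleftrightarrow> (v, u) \<notin> parcs T"

(* Vertices of a closed traversal; positions are cyclic. *)
definition cyc_nth :: "'a list \<Rightarrow> nat \<Rightarrow> 'a" where
  "cyc_nth xs i = xs ! (i mod length xs)"

(* An oriented cycle is its arc set C. A traversal lists its vertices in cyclic order, starting at
   any vertex and going round in either sense; C contains exactly one of the two possible arcs
   between cyclically consecutive vertices, and no other arc. *)
definition traversal :: "'a rel \<Rightarrow> 'a list \<Rightarrow> bool" where
  "traversal C xs \<longleftrightarrow>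
     3 \<le> length xs \<and> distinct xs \<and>
     (\<forall>i < length xs. (cyc_nth xs i, cyc_nth xs (Suc i)) \<in> C
                       \<longleftrightarrow> (cyc_nth xs (Suc i), cyc_nth xs i) \<notin> C) \<and>
     C \<subseteq> (\<Union>i < length xs. {(cyc_nth xs i, cyc_nth xs (Suc i)), (cyc_nth xs (Suc i), cyc_nth xs i)})"

definition oriented_cycle :: "'a pair_pre_digraph \<Rightarrow> 'a rel \<Rightarrow> bool" where
  "oriented_cycle T C \<longleftrightarrow> C \<subseteq> parcs T \<and> (\<exists>xs. traversal C xs)"

(* The i-th arc of the traversal points in the sense of the traversal. *)
definition forward :: "'a rel \<Rightarrow> 'a list \<Rightarrow> nat \<Rightarrow> bool" where
  "forward C xs i \<longleftrightarrow> (cyc_nth xs i, cyc_nth xs (Suc i)) \<in> C"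

(* The l arcs from position p on form a maximal directed subpath, pointing in the sense of the
   traversal iff d. Maximality: the arcs just after and just before (position p - 1, taken
   cyclically) have the other direction. A circuit, where l is the length of the cycle, is a
   single block, starting at any position. *)
definition block :: "'a rel \<Rightarrow> 'a list \<Rightarrow> nat \<Rightarrow> nat \<Rightarrow> bool \<Rightarrow> bool" where
  "block C xs p l d \<longleftrightarrow>
     1 \<le> l \<and> l \<le> length xs \<and> (\<forall>i \<in> {p..<p + l}. forward C xs i = d) \<and>
     (l = length xs \<or>
       forward C xs (p + l) \<noteq> d \<and> forward C xs (p + length xs - 1) \<noteq> d)"

(* The blocks I_1, ..., I_s are consecutive, the first one starting at position 0; since their
   lengths add up to the length of the cycle, there are no others. *)
definition has_type :: "'a rel \<Rightarrow> int list \<Rightarrow> bool" where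
  "has_type C \<alpha> \<longleftrightarrow>
     (\<exists>xs. traversal C xs \<and> length xs = (\<Sum>a\<leftarrow>\<alpha>. nat \<bar>a\<bar>) \<and>
       (\<forall>i < length \<alpha>. block C xs (\<Sum>j < i. nat \<bar>\<alpha> ! j\<bar>) (nat \<bar>\<alpha> ! i\<bar>) (\<alpha> ! i > 0)))"

definition num_cycles :: "'a pair_pre_digraph \<Rightarrow> int list \<Rightarrow> nat" where
  "num_cycles T \<alpha> = card {C. oriented_cycle T C \<and> has_type C \<alpha>}"

end

theory Submission
  imports Defs "HOL-Combinatorics.Multiset_Permutations"
begin

text \<open>Let \<open>s(u, v) = \<plusminus>1\<close> record the direction of the arc between \<open>u\<close> and \<open>v\<close>, so that \<open>s\<close> is
antisymmetric. The number of vertex orderings with a prescribed cyclic direction pattern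
\<open>\<epsilon> \<in> {1, -1}\<^sup>n\<close> is \<open>2\<^sup>-\<^sup>n \<Sum>\<^sub>x \<Prod>\<^sub>i (1 + \<epsilon>\<^sub>i s(x\<^sub>i, x\<^sub>i\<^sub>+\<^sub>1))\<close>. Expanding the product over sets \<open>S\<close> of
positions, the term of \<open>S\<close> vanishes if \<open>S\<close> has odd size: some component of \<open>S\<close> in the cycle
has oddly many edges, and reversing the vertices along it changes the sign. Only even terms
remain, and these are invariant under \<open>\<epsilon> \<mapsto> -\<epsilon>\<close>. Finally, each cycle arises from as many
orderings as the oriented cycle with pattern \<open>\<epsilon>\<close> has automorphisms; negating \<open>\<epsilon>\<close> reverses all
arcs of that cycle, which does not affect its automorphisms.\<close>

section \<open>Signed sums over vertex orderings\<close>

lemma length_permutations_of_set: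
  "xs \<in> permutations_of_set V \<Longrightarrow> length xs = card V"
  by (auto simp: permutations_of_set_def distinct_card)

lemma permute_list_in_permutations_of_set:
  assumes "\<pi> permutes {..<card V}" "xs \<in> permutations_of_set V"
  shows "permute_list \<pi> xs \<in> permutations_of_set V"
  using assms length_permutations_of_set[OF assms(2)]
  by (auto simp: permutations_of_set_def)

lemma bij_betw_permute_list:
  assumes p: "\<pi> permutes {..<card V}"
  shows "bij_betw (permute_list \<pi>) (permutations_of_set V) (permutations_of_set V)"
proof (rule bij_betw_byWitness[where f' = "permute_list (inv \<pi>)"])
  have q: "inv \<pi> permutes {..<card V}"
    using p by (rule permutes_inv)
  show "\<forall>xs\<in>permutations_of_set V. permute_list (inv \<pi>) (permute_list \<pi> xs) = xs"
    using q permutes_inv_o(1)[OF p]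
    by (auto simp: length_permutations_of_set simp flip: permute_list_compose)
  show "\<forall>xs\<in>permutations_of_set V. permute_list \<pi> (permute_list (inv \<pi>) xs) = xs"
    using p permutes_inv_o(2)[OF p]
    by (auto simp: length_permutations_of_set simp flip: permute_list_compose)
  show "permute_list \<pi> ` permutations_of_set V \<subseteq> permutations_of_set V"
    using p by (auto intro: permute_list_in_permutations_of_set)
  show "permute_list (inv \<pi>) ` permutations_of_set V \<subseteq> permutations_of_set V"
    using q by (auto intro: permute_list_in_permutations_of_set)
qed

text \<open>The term of \<open>S\<close> in the expanded product, before the pattern signs are
  multiplied in. Position \<open>i\<close> also stands for the arc from the \<open>i\<close>-th
  vertex to the cyclically next one.\<close>

definition signed_sum :: "('a \<Rightarrow> 'a \<Rightarrow> int) \<Rightarrow> 'a set \<Rightarrow> nat set \<Rightarrow> int" where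
  "signed_sum s V S =
     (\<Sum>xs\<in>permutations_of_set V. \<Prod>i\<in>S. s (xs ! i) (xs ! (Suc i mod card V)))"

text \<open>Rearranging every ordering by \<open>\<pi>\<close> merely permutes the summands. Here
  \<open>\<tau>\<close> says to which arc position an arc moves, and \<open>c\<close> is -1 where
  its endpoints get exchanged. Used for two reversals and a rotation.\<close>

lemma signed_sum_reindex:
  assumes p: "\<pi> permutes {..<card V}" and S: "S \<subseteq> {..<card V}" and \<tau>: "bij_betw \<tau> S S'"
    and step: "\<And>xs i. xs \<in> permutations_of_set V \<Longrightarrow> i \<in> S \<Longrightarrow>
      s (xs ! \<pi> i) (xs ! \<pi> (Suc i mod card V)) = c i * s (xs ! \<tau> i) (xs ! (Suc (\<tau> i) mod card V))"
  shows "signed_sum s V S = prod c S * signed_sum s V S'"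
proof -
  let ?f = "\<lambda>xs i. s (xs ! i) (xs ! (Suc i mod card V))"
  have "signed_sum s V S = (\<Sum>xs\<in>permutations_of_set V. \<Prod>i\<in>S. ?f (permute_list \<pi> xs) i)"
    unfolding signed_sum_def by (rule sum.reindex_bij_betw[OF bij_betw_permute_list[OF p], symmetric])
  also have "\<dots> = (\<Sum>xs\<in>permutations_of_set V. prod c S * (\<Prod>i\<in>S'. ?f xs i))"
  proof (rule sum.cong[OF refl])
    fix xs assume xs: "xs \<in> permutations_of_set V"
    have "(\<Prod>i\<in>S. ?f (permute_list \<pi> xs) i) = (\<Prod>i\<in>S. c i * ?f xs (\<tau> i))"
    proof (rule prod.cong[OF refl])
      fix i assume i: "i \<in> S"
      hence "i < card V" "Suc i mod card V < card V"
        using S by auto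
      thus "?f (permute_list \<pi> xs) i = c i * ?f xs (\<tau> i)"
        using step[OF xs i] p by (simp add: permute_list_nth length_permutations_of_set[OF xs])
    qed
    also have "\<dots> = prod c S * (\<Prod>i\<in>S. ?f xs (\<tau> i))"
      by (rule prod.distrib)
    also have "(\<Prod>i\<in>S. ?f xs (\<tau> i)) = (\<Prod>i\<in>S'. ?f xs i)"
      by (rule prod.reindex_bij_betw[OF \<tau>])
    finally show "(\<Prod>i\<in>S. ?f (permute_list \<pi> xs) i) = prod c S * (\<Prod>i\<in>S'. ?f xs i)" .
  qed
  finally show ?thesis
    by (simp add: signed_sum_def sum_distrib_left)
qed

text \<open>The sizes of the maximal runs add up to \<open>card S\<close>, so they cannot all be
  even. The last conjunct says that \<open>a - 1\<close> is not in \<open>S\<close>, phrased so that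
  \<open>a = 0\<close> is covered.\<close>

lemma odd_run_exists:
  fixes S :: "nat set"
  assumes "finite S" "odd (card S)"
  shows "\<exists>a b. a < b \<and> odd (b - a) \<and> {a..<b} \<subseteq> S \<and> b \<notin> S \<and> (\<forall>i. Suc i = a \<longrightarrow> i \<notin> S)"
  using assms
proof (induction "card S" arbitrary: S rule: less_induct)
  case less
  from less.prems have "S \<noteq> {}" by auto
  define a where "a = Min S"
  have a: "a \<in> S" "\<And>i. i \<in> S \<Longrightarrow> a \<le> i"
    using \<open>S \<noteq> {}\<close> less.prems by (auto simp: a_def)
  have "\<exists>b. b \<ge> a \<and> b \<notin> S"
    using less.prems(1) by (meson finite_nat_set_iff_bounded_le nat_le_linear not_less_eq_eq)
  define b where "b = (LEAST b. b \<ge> a \<and> b \<notin> S)"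
  have b: "b \<ge> a" "b \<notin> S"
    using LeastI_ex[OF \<open>\<exists>b. b \<ge> a \<and> b \<notin> S\<close>] by (auto simp: b_def)
  have "a < b"
    using a b by (metis nat_less_le)
  have sub: "{a..<b} \<subseteq> S"
  proof
    fix i assume "i \<in> {a..<b}"
    thus "i \<in> S"
      using not_less_Least[of i "\<lambda>b. b \<ge> a \<and> b \<notin> S"] unfolding b_def[symmetric] by simp
  qed
  show ?case
  proof (cases "odd (b - a)")
    case True
    moreover have "\<forall>i. Suc i = a \<longrightarrow> i \<notin> S"
      using a(2) by fastforce
    ultimately show ?thesis
      using \<open>a < b\<close> sub b by blast
  next
    case False
    define S' where "S' = S - {a..<b}"
    have card: "card S = card S' + (b - a)"
      using card_Diff_subset[OF _ sub] card_mono[OF less.prems(1) sub] by (simp add: S'_def)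
    hence "card S' < card S" "odd (card S')"
      using \<open>a < b\<close> False less.prems(2) by auto
    then obtain c d where cd: "c < d" "odd (d - c)" "{c..<d} \<subseteq> S'" "d \<notin> S'"
        "\<forall>i. Suc i = c \<longrightarrow> i \<notin> S'"
      using less.hyps[of S'] less.prems by (auto simp: S'_def)
    \<comment> \<open>The gap at \<open>b\<close> separates the leftmost run from the rest, so a
      maximal run of \<open>S'\<close> is still maximal in \<open>S\<close>.\<close>
    have S'b: "i > b" if "i \<in> S'" for i
    proof -
      have "i \<in> S" "\<not> (a \<le> i \<and> i < b)"
        using that by (auto simp: S'_def)
      moreover from this have "a \<le> i" "i \<noteq> b"
        using a(2) b(2) by auto
      ultimately show ?thesis by linarith
    qed
    have "c \<in> S'"
      using cd by auto
    hence "c > b"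
      by (rule S'b)
    hence "d \<notin> S" "\<forall>i. Suc i = c \<longrightarrow> i \<notin> S"
      using cd by (auto simp: S'_def)
    moreover have "{c..<d} \<subseteq> S"
      using cd(3) by (auto simp: S'_def)
    ultimately show ?thesis
      using cd(1,2) by blast
  qed
qed

section \<open>Vanishing of the signed sums over sets of odd size\<close>

lemma involution_permutes:
  assumes "\<And>i. i \<in> A \<Longrightarrow> f i \<in> A" "\<And>i. i \<in> A \<Longrightarrow> f (f i) = i" "\<And>i. i \<notin> A \<Longrightarrow> f i = i"
  shows "f permutes A"
  using assms by (intro bij_imp_permutes bij_betw_byWitness[where f' = f]) auto

text \<open>Only distinct vertices are compared: the sign used later takes just the values 1 and -1,
  so it cannot be antisymmetric on the diagonal.\<close>

locale antisymmetric_sign =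
  fixes s :: "'a \<Rightarrow> 'a \<Rightarrow> int" and V :: "'a set"
  assumes antisym: "u \<in> V \<Longrightarrow> v \<in> V \<Longrightarrow> u \<noteq> v \<Longrightarrow> s v u = - s u v"
begin

lemma sign_swap:
  assumes "xs \<in> permutations_of_set V" "i < card V" "j < card V" "i \<noteq> j"
  shows "s (xs ! j) (xs ! i) = - s (xs ! i) (xs ! j)"
  using assms length_permutations_of_set[OF assms(1)]
  by (intro antisym) (auto simp: permutations_of_set_def nth_eq_iff_index_eq)

text \<open>Reversing one maximal run of odd length in \<open>S\<close> changes the sign of every summand.\<close>

lemma signed_sum_eq_0_linear:
  assumes S: "S \<subseteq> {..<card V - 1}" and odd: "odd (card S)"
  shows "signed_sum s V S = 0"
proof -
  let ?n = "card V"
  have fin: "finite S"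
    using S finite_subset by blast
  obtain a b where ab: "a < b" "odd (b - a)" "{a..<b} \<subseteq> S" "b \<notin> S" "\<And>i. Suc i = a \<Longrightarrow> i \<notin> S"
    using odd_run_exists[OF fin odd] by blast
  \<comment> \<open>The closing arc \<open>?n - 1\<close> is not in \<open>S\<close>, so the run
    does not wrap around.\<close>
  have bn: "b < ?n"
  proof -
    have "b - 1 \<in> S"
      using ab(1,3) by auto
    thus ?thesis using S by auto
  qed
  \<comment> \<open>The arcs \<open>a\<close> to \<open>b - 1\<close> have the vertices
    \<open>a\<close> to \<open>b\<close>: \<open>\<pi>\<close> reflects the vertices and
    \<open>\<tau>\<close> the arcs, whence the shift by one.\<close>
  define \<pi> where "\<pi> i = (if a \<le> i \<and> i \<le> b then a + b - i else i)" for i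
  define \<tau> where "\<tau> i = (if a \<le> i \<and> i < b then a + b - 1 - i else i)" for i
  define c :: "nat \<Rightarrow> int" where "c i = (if i \<in> {a..<b} then -1 else 1)" for i
  have "\<pi> permutes {..<?n}"
    using bn by (intro involution_permutes) (auto simp: \<pi>_def)
  moreover have "bij_betw \<tau> S S"
  proof -
    have "\<tau> i \<in> S" if "i \<in> S" for i
    proof (cases "a \<le> i \<and> i < b")
      case True
      hence "\<tau> i \<in> {a..<b}"
        by (auto simp: \<tau>_def)
      thus ?thesis using ab(3) by blast
    qed (use that in \<open>auto simp: \<tau>_def\<close>)
    moreover have "\<tau> (\<tau> i) = i" for i
      by (auto simp: \<tau>_def)
    ultimately show ?thesis
      by (intro bij_betw_byWitness[where f' = \<tau>]) auto
  qed
  moreover have "s (xs ! \<pi> i) (xs ! \<pi> (Suc i mod ?n)) = c i * s (xs ! \<tau> i) (xs ! (Suc (\<tau> i) mod ?n))"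
    if xs: "xs \<in> permutations_of_set V" and i: "i \<in> S" for xs i
  proof (cases "i \<in> {a..<b}")
    case True
    define j where "j = a + b - 1 - i"
    have j: "\<tau> i = j" "\<pi> i = Suc j" "\<pi> (Suc i) = j" "Suc j < ?n" "Suc i < ?n"
      using True bn by (auto simp: \<tau>_def \<pi>_def j_def)
    show ?thesis
      using True sign_swap[OF xs, of j "Suc j"] j by (simp add: c_def)
  next
    case False
    \<comment> \<open>By maximality of the run, an arc of \<open>S\<close> outside it has no
      endpoint among the reversed vertices.\<close>
    have "i \<noteq> b"
      using ab(4) i by auto
    moreover have "Suc i \<noteq> a"
      using ab(5) i by auto
    ultimately have "\<tau> i = i" "\<pi> i = i" "\<pi> (Suc i) = Suc i"
      using False by (auto simp: \<tau>_def \<pi>_def)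
    moreover have "Suc i < ?n"
      using i S by auto
    moreover have "c i = 1"
      using False by (simp add: c_def)
    ultimately show ?thesis by simp
  qed
  ultimately have "signed_sum s V S = prod c S * signed_sum s V S"
    using S by (intro signed_sum_reindex[where \<pi> = \<pi> and \<tau> = \<tau>]) auto
  moreover have "prod c S = (\<Prod>i\<in>{a..<b}. c i)"
    using ab(3) fin by (intro prod.mono_neutral_right) (auto simp: c_def)
  hence "prod c S = -1"
    using ab(2) by (simp add: c_def)
  ultimately show ?thesis by simp
qed

text \<open>With no gap there is no run to isolate, but reversing the whole ordering flips all arcs,
  an odd number. A single vertex is excluded because its only arc position is a loop, to which
  antisymmetry does not apply.\<close>

lemma signed_sum_eq_0_full:
  assumes "odd (card V)" "card V \<noteq> 1"
  shows "signed_sum s V {..<card V} = 0"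
proof -
  let ?n = "card V"
  have n: "?n \<ge> 2"
    using assms by (cases "?n") auto
  define \<pi> where "\<pi> i = (if i < ?n then ?n - 1 - i else i)" for i
  \<comment> \<open>The closing arc joins the last vertex to vertex 0 and is mapped to itself; the
    other arcs are reflected.\<close>
  define \<tau> where "\<tau> i = (if i = ?n - 1 then ?n - 1 else ?n - 2 - i)" for i
  have "\<pi> permutes {..<?n}"
    by (intro involution_permutes) (auto simp: \<pi>_def)
  moreover have "bij_betw \<tau> {..<?n} {..<?n}"
    using n by (intro bij_betw_byWitness[where f' = \<tau>]) (auto simp: \<tau>_def)
  moreover have "s (xs ! \<pi> i) (xs ! \<pi> (Suc i mod ?n)) = -1 * s (xs ! \<tau> i) (xs ! (Suc (\<tau> i) mod ?n))"
    if xs: "xs \<in> permutations_of_set V" and i: "i \<in> {..<?n}" for xs i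
  proof (cases "i = ?n - 1")
    case True
    hence "\<tau> i = ?n - 1" "\<pi> i = 0" "Suc i mod ?n = 0" "\<pi> 0 = ?n - 1"
      using n by (auto simp: \<tau>_def \<pi>_def)
    thus ?thesis
      using sign_swap[OF xs, of "?n - 1" 0] n by simp
  next
    case False
    define j where "j = ?n - 2 - i"
    have "\<tau> i = j" "\<pi> i = Suc j" "\<pi> (Suc i) = j" "Suc j < ?n" "Suc i < ?n"
      using False i n by (auto simp: \<tau>_def \<pi>_def j_def)
    thus ?thesis
      using sign_swap[OF xs, of j "Suc j"] by simp
  qed
  ultimately have "signed_sum s V {..<?n} = (\<Prod>i<?n. -1) * signed_sum s V {..<?n}"
    by (intro signed_sum_reindex[where \<pi> = \<pi> and \<tau> = \<tau>]) auto
  thus ?thesis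
    using assms by simp
qed

text \<open>A set missing some position \<open>k\<close> is rotated until \<open>k\<close> becomes
  the closing arc, which reduces it to the linear case.\<close>

lemma signed_sum_eq_0:
  assumes S: "S \<subseteq> {..<card V}" and odd: "odd (card S)" and n: "card V \<noteq> 1"
  shows "signed_sum s V S = 0"
proof (cases "S = {..<card V}")
  case True
  thus ?thesis
    using signed_sum_eq_0_full odd n by simp
next
  case False
  let ?n = "card V"
  obtain k where k: "k < ?n" "k \<notin> S"
    using False S by auto
  \<comment> \<open>The shift is chosen so that \<open>r\<close> sends the last position to
    \<open>k\<close>; \<open>r'\<close> shifts back without subtraction.\<close>
  define r where "r i = (i + Suc k) mod ?n" for i
  define r' where "r' i = (i + (?n - Suc k)) mod ?n" for i
  define S' where "S' = {i. i < ?n \<and> r i \<in> S}"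
  have rr: "r' (r i) = i" "r (r' i) = i" if "i < ?n" for i
  proof -
    have "r' (r i) = (i + Suc k + (?n - Suc k)) mod ?n"
      unfolding r_def r'_def by (rule mod_add_left_eq)
    also have "i + Suc k + (?n - Suc k) = i + ?n"
      using k by simp
    finally show "r' (r i) = i"
      using that by simp
    have "r (r' i) = (i + (?n - Suc k) + Suc k) mod ?n"
      unfolding r_def r'_def by (rule mod_add_left_eq)
    also have "i + (?n - Suc k) + Suc k = i + ?n"
      using k by simp
    finally show "r (r' i) = i"
      using that by simp
  qed
  have lt: "r i < ?n" "r' i < ?n" for i
    using k by (auto simp: r_def r'_def)
  have "bij_betw r {..<?n} {..<?n}"
    using rr lt by (intro bij_betw_byWitness[where f' = r']) auto
  \<comment> \<open>\<open>permutes\<close> demands the identity outside the positions, whereas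
    \<open>r\<close> wraps every number into them.\<close>
  also have "?this \<longleftrightarrow> bij_betw (\<lambda>i. if i < ?n then r i else i) {..<?n} {..<?n}"
    by (intro bij_betw_cong) simp
  finally have "(\<lambda>i. if i < ?n then r i else i) permutes {..<?n}"
    by (rule bij_imp_permutes) simp
  moreover have bij: "bij_betw r S' S"
    using rr lt S by (intro bij_betw_byWitness[where f' = r']) (auto simp: S'_def)
  moreover have "r (Suc i mod ?n) = Suc (r i) mod ?n" for i
    unfolding r_def mod_add_left_eq mod_Suc_eq by simp
  ultimately have "signed_sum s V S' = (\<Prod>i\<in>S'. 1) * signed_sum s V S"
    using lt by (intro signed_sum_reindex[where \<pi> = "\<lambda>i. if i < ?n then r i else i" and \<tau> = r])
      (auto simp: S'_def)
  moreover have "r (?n - 1) = k"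
    using k by (simp add: r_def)
  hence "S' \<subseteq> {..<?n - 1}"
    using k by (fastforce simp: S'_def nat_less_le)
  moreover have "card S' = card S"
    using bij by (rule bij_betw_same_card)
  ultimately show ?thesis
    using signed_sum_eq_0_linear[of S'] odd by simp
qed

end

section \<open>Counting orderings with a prescribed direction pattern\<close>

definition pattern_orderings :: "'a rel \<Rightarrow> 'a set \<Rightarrow> (nat \<Rightarrow> bool) \<Rightarrow> 'a list set" where
  "pattern_orderings A V w =
     {xs \<in> permutations_of_set V. \<forall>i<card V. (xs ! i, xs ! (Suc i mod card V)) \<in> A \<longleftrightarrow> w i}"

text \<open>Each condition is encoded as a factor \<open>1 + \<epsilon> s \<in> {0, 2}\<close> with \<open>\<epsilon>, s = \<plusminus>1\<close>.\<close>

lemma card_pattern_orderings: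
  fixes A :: "'a rel"
  defines "s \<equiv> \<lambda>u v. if (u, v) \<in> A then 1 else -1"
  shows "2 ^ card V * int (card (pattern_orderings A V w)) =
    (\<Sum>S\<in>Pow {..<card V}. (\<Prod>i\<in>S. if w i then 1 else -1) * signed_sum s V S)"
proof -
  let ?n = "card V" and ?P = "permutations_of_set V"
  define \<epsilon> :: "nat \<Rightarrow> int" where "\<epsilon> i = (if w i then 1 else -1)" for i
  define t where "t xs i = s (xs ! i) (xs ! (Suc i mod ?n))" for xs i
  have factor: "(\<Prod>i<?n. \<epsilon> i * t xs i + 1) = (if xs \<in> pattern_orderings A V w then 2 ^ ?n else 0)"
    if xs: "xs \<in> ?P" for xs
  proof (cases "xs \<in> pattern_orderings A V w")
    case True
    hence "(\<Prod>i<?n. \<epsilon> i * t xs i + 1) = (\<Prod>i<?n. 2)"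
      by (intro prod.cong) (auto simp: pattern_orderings_def \<epsilon>_def t_def s_def)
    thus ?thesis using True by simp
  next
    case False
    then obtain i where "i < ?n" "((xs ! i, xs ! (Suc i mod ?n)) \<in> A) \<noteq> w i"
      using xs by (auto simp: pattern_orderings_def)
    hence "\<exists>i\<in>{..<?n}. \<epsilon> i * t xs i + 1 = 0"
      by (auto simp: \<epsilon>_def t_def s_def)
    thus ?thesis using False by (simp add: prod_zero)
  qed
  have "2 ^ ?n * int (card (pattern_orderings A V w)) = (\<Sum>xs\<in>pattern_orderings A V w. 2 ^ ?n)"
    by simp
  also have "\<dots> = (\<Sum>xs\<in>?P. if xs \<in> pattern_orderings A V w then 2 ^ ?n else 0)"
    by (intro sum.mono_neutral_cong_left) (auto simp: pattern_orderings_def)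
  also have "\<dots> = (\<Sum>xs\<in>?P. \<Prod>i<?n. \<epsilon> i * t xs i + 1)"
    using factor by simp
  also have "\<dots> = (\<Sum>xs\<in>?P. \<Sum>S\<in>Pow {..<?n}. prod \<epsilon> S * prod (t xs) S)"
    by (simp add: prod_add prod.distrib)
  also have "\<dots> = (\<Sum>S\<in>Pow {..<?n}. prod \<epsilon> S * signed_sum s V S)"
    by (subst sum.swap) (simp add: signed_sum_def t_def sum_distrib_left)
  finally show ?thesis
    by (simp add: \<epsilon>_def)
qed

text \<open>The two expansions agree term by term: odd sets contribute 0, and on even sets the
  negated signs cancel. For one vertex the claim fails, since the only condition concerns a
  loop.\<close>

lemma card_pattern_orderings_not:
  assumes A: "\<And>u v. u \<in> V \<Longrightarrow> v \<in> V \<Longrightarrow> u \<noteq> v \<Longrightarrow> (u, v) \<in> A \<longleftrightarrow> (v, u) \<notin> A"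
    and n: "card V \<noteq> 1"
  shows "card (pattern_orderings A V (\<lambda>i. \<not> w i)) = card (pattern_orderings A V w)"
proof -
  define s :: "'a \<Rightarrow> 'a \<Rightarrow> int" where "s = (\<lambda>u v. if (u, v) \<in> A then 1 else -1)"
  interpret antisymmetric_sign s V
  proof
    fix u v assume "u \<in> V" "v \<in> V" "u \<noteq> v"
    thus "s v u = - s u v"
      using A[of u v] by (simp add: s_def)
  qed
  have "(\<Prod>i\<in>S. if \<not> w i then 1 else -1) * signed_sum s V S
      = (\<Prod>i\<in>S. if w i then 1 else -1) * signed_sum s V S" if "S \<in> Pow {..<card V}" for S
  proof (cases "odd (card S)")
    case True
    thus ?thesis using signed_sum_eq_0[of S] that n by simp
  next
    case False
    have "(\<Prod>i\<in>S. if \<not> w i then 1 else -1 :: int) = (\<Prod>i\<in>S. - (if w i then 1 else -1))"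
      by (intro prod.cong) auto
    also have "\<dots> = (\<Prod>i\<in>S. if w i then 1 else -1)"
      using False by (subst prod_uminus) simp
    finally show ?thesis by simp
  qed
  hence "2 ^ card V * int (card (pattern_orderings A V (\<lambda>i. \<not> w i)))
      = 2 ^ card V * int (card (pattern_orderings A V w))"
    unfolding card_pattern_orderings s_def[symmetric] by (intro sum.cong) auto
  thus ?thesis by simp
qed

section \<open>From orderings to cycles\<close>

text \<open>A template on positions. The cycles with pattern \<open>w\<close> are its images under
  vertex orderings, so its symmetries determine how often each cycle is produced.\<close>

definition oriented_ring :: "nat \<Rightarrow> (nat \<Rightarrow> bool) \<Rightarrow> nat rel" where
  "oriented_ring n w = (\<lambda>i. if w i then (i, Suc i mod n) else (Suc i mod n, i)) ` {..<n}"

definition place :: "'a list \<Rightarrow> nat rel \<Rightarrow> 'a rel" where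
  "place xs R = map_prod ((!) xs) ((!) xs) ` R"

definition ring_automorphisms :: "nat \<Rightarrow> nat rel \<Rightarrow> (nat \<Rightarrow> nat) set" where
  "ring_automorphisms n R = {\<pi>. \<pi> permutes {..<n} \<and> map_prod \<pi> \<pi> ` R = R}"

lemma oriented_ring_subset: "oriented_ring n w \<subseteq> {..<n} \<times> {..<n}"
  by (auto simp: oriented_ring_def)

lemma oriented_ring_not: "oriented_ring n (\<lambda>i. \<not> w i) = (oriented_ring n w)\<inverse>"
  by (auto simp: oriented_ring_def image_iff split: if_splits)

text \<open>Taking images commutes with converse. As negating the pattern yields the converse ring,
  both patterns have the same multiplicity.\<close>

lemma ring_automorphisms_converse: "ring_automorphisms n (R\<inverse>) = ring_automorphisms n R"
proof -
  have "map_prod \<pi> \<pi> ` (R\<inverse>) = (map_prod \<pi> \<pi> ` R)\<inverse>" for \<pi> :: "nat \<Rightarrow> nat"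
    by force
  thus ?thesis
    by (simp add: ring_automorphisms_def)
qed

lemma mem_oriented_ring_iff:
  assumes n: "n \<ge> 3" and i: "i < n"
  shows "(i, Suc i mod n) \<in> oriented_ring n w \<longleftrightarrow> w i"
    and "(Suc i mod n, i) \<in> oriented_ring n w \<longleftrightarrow> \<not> w i"
proof -
  \<comment> \<open>Here \<open>n \<ge> 3\<close> matters: for \<open>n = 2\<close> both ring
    positions join the same pair and could contradict each other.\<close>
  have neq: "Suc (Suc i mod n) mod n \<noteq> i"
    using assms by (auto simp: mod_Suc)
  show "(i, Suc i mod n) \<in> oriented_ring n w \<longleftrightarrow> w i"
    using neq i by (auto simp: oriented_ring_def image_iff split: if_splits)
  show "(Suc i mod n, i) \<in> oriented_ring n w \<longleftrightarrow> \<not> w i"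
    using neq i by (auto simp: oriented_ring_def image_iff split: if_splits)
qed

lemma place_permute_list:
  assumes "\<pi> permutes {..<length xs}" "R \<subseteq> {..<length xs} \<times> {..<length xs}"
  shows "place (permute_list \<pi> xs) R = place xs (map_prod \<pi> \<pi> ` R)"
proof -
  have "map_prod ((!) (permute_list \<pi> xs)) ((!) (permute_list \<pi> xs)) e
      = map_prod ((!) xs) ((!) xs) (map_prod \<pi> \<pi> e)" if "e \<in> R" for e
    using that assms by (cases e) (auto simp: permute_list_nth)
  thus ?thesis
    by (simp add: place_def image_image)
qed

lemma place_eq_iff:
  assumes "distinct xs" "R \<subseteq> {..<length xs} \<times> {..<length xs}" "R' \<subseteq> {..<length xs} \<times> {..<length xs}"
  shows "place xs R = place xs R' \<longleftrightarrow> R = R'"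
proof -
  have "inj_on (map_prod ((!) xs) ((!) xs)) ({..<length xs} \<times> {..<length xs})"
    using assms(1) by (intro map_prod_inj_on inj_on_nth) auto
  thus ?thesis
    unfolding place_def using assms(2,3) by (rule inj_on_image_eq_iff)
qed

lemma mem_place_iff:
  assumes "distinct xs" "R \<subseteq> {..<length xs} \<times> {..<length xs}" "i < length xs" "j < length xs"
  shows "(xs ! i, xs ! j) \<in> place xs R \<longleftrightarrow> (i, j) \<in> R"
proof
  assume "(xs ! i, xs ! j) \<in> place xs R"
  then obtain k l where kl: "(k, l) \<in> R" "xs ! i = xs ! k" "xs ! j = xs ! l"
    by (auto simp: place_def)
  hence "k < length xs" "l < length xs"
    using assms(2) by auto
  thus "(i, j) \<in> R"
    using kl assms by (simp add: nth_eq_iff_index_eq)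
qed (force simp: place_def)

text \<open>Orbit-stabiliser argument: each ordering is \<open>permute_list \<pi> xs\<close> for a
  unique \<open>\<pi>\<close>, and it places \<open>R\<close> on the same arcs iff
  \<open>\<pi>\<close> stabilises \<open>R\<close>.\<close>

lemma card_place_fibre:
  assumes xs: "xs \<in> permutations_of_set V" and R: "R \<subseteq> {..<card V} \<times> {..<card V}"
  shows "card {ys \<in> permutations_of_set V. place ys R = place xs R}
    = card (ring_automorphisms (card V) R)"
proof -
  let ?n = "card V"
  have len: "length xs = ?n" and dist: "distinct xs"
    using xs by (auto simp: length_permutations_of_set permutations_of_set_def)
  have place: "place (permute_list \<pi> xs) R = place xs R \<longleftrightarrow> map_prod \<pi> \<pi> ` R = R"
    if p: "\<pi> permutes {..<?n}" for \<pi>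
  proof -
    have "map_prod \<pi> \<pi> ` R \<subseteq> {..<?n} \<times> {..<?n}"
      using R permutes_in_image[OF p] by auto
    thus ?thesis
      using p R dist len by (simp add: place_permute_list place_eq_iff)
  qed
  have inj: "inj_on (\<lambda>\<pi>. permute_list \<pi> xs) (ring_automorphisms ?n R)"
  proof (rule inj_onI)
    fix \<pi> \<rho> assume "\<pi> \<in> ring_automorphisms ?n R" "\<rho> \<in> ring_automorphisms ?n R"
      and eq: "permute_list \<pi> xs = permute_list \<rho> xs"
    hence p: "\<pi> permutes {..<?n}" "\<rho> permutes {..<?n}"
      by (auto simp: ring_automorphisms_def)
    show "\<pi> = \<rho>"
    proof
      fix i
      show "\<pi> i = \<rho> i"
      proof (cases "i < ?n")
        case True
        have "xs ! \<pi> i = xs ! \<rho> i"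
          using arg_cong[OF eq, of "\<lambda>ys. ys ! i"] p True by (simp add: permute_list_nth len)
        thus ?thesis
          using dist len True permutes_in_image[OF p(1), of i] permutes_in_image[OF p(2), of i]
          by (simp add: nth_eq_iff_index_eq)
      next
        case False
        thus ?thesis
          using p by (simp add: permutes_def)
      qed
    qed
  qed
  have "{ys \<in> permutations_of_set V. place ys R = place xs R}
      = (\<lambda>\<pi>. permute_list \<pi> xs) ` ring_automorphisms ?n R"
  proof (intro equalityI subsetI)
    fix ys assume ys: "ys \<in> {ys \<in> permutations_of_set V. place ys R = place xs R}"
    hence "mset ys = mset xs"
      using xs by (auto simp: permutations_of_set_def set_eq_iff_mset_eq_distinct[symmetric])
    then obtain \<pi> where "\<pi> permutes {..<length xs}" "permute_list \<pi> xs = ys"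
      by (rule mset_eq_permutation)
    thus "ys \<in> (\<lambda>\<pi>. permute_list \<pi> xs) ` ring_automorphisms ?n R"
      using ys place len by (auto simp: ring_automorphisms_def)
  next
    fix ys assume "ys \<in> (\<lambda>\<pi>. permute_list \<pi> xs) ` ring_automorphisms ?n R"
    thus "ys \<in> {ys \<in> permutations_of_set V. place ys R = place xs R}"
      using xs place by (auto simp: ring_automorphisms_def permute_list_in_permutations_of_set)
  qed
  thus ?thesis
    using inj by (simp add: card_image)
qed

text \<open>All fibres of the placing map have the same size, so orderings are counted cycle by
  cycle.\<close>

lemma card_place_orderings:
  assumes R: "R \<subseteq> {..<card V} \<times> {..<card V}"
  shows "card {xs \<in> permutations_of_set V. place xs R \<subseteq> A}
    = card (ring_automorphisms (card V) R)
      * card ((\<lambda>xs. place xs R) ` {xs \<in> permutations_of_set V. place xs R \<subseteq> A})"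
proof -
  let ?H = "{xs \<in> permutations_of_set V. place xs R \<subseteq> A}"
  have "card ?H = (\<Sum>C\<in>(\<lambda>xs. place xs R) ` ?H. card {xs \<in> ?H. place xs R = C})"
    using sum.image_gen[of ?H "\<lambda>_. 1::nat" "\<lambda>xs. place xs R"] by simp
  also have "\<dots> = (\<Sum>C\<in>(\<lambda>xs. place xs R) ` ?H. card (ring_automorphisms (card V) R))"
  proof (rule sum.cong[OF refl])
    fix C assume "C \<in> (\<lambda>xs. place xs R) ` ?H"
    then obtain xs where xs: "xs \<in> permutations_of_set V" "C = place xs R" "C \<subseteq> A"
      by auto
    \<comment> \<open>Containment in \<open>A\<close> depends only on the placed relation, so
      \<open>?H\<close> contains the whole fibre.\<close>
    hence "{xs \<in> ?H. place xs R = C} = {ys \<in> permutations_of_set V. place ys R = place xs R}"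
      by auto
    thus "card {xs \<in> ?H. place xs R = C} = card (ring_automorphisms (card V) R)"
      using card_place_fibre[OF xs(1) R] by simp
  qed
  finally show ?thesis by simp
qed

text \<open>Where \<open>w i\<close> is false the ring needs the backward arc, and this lies in
  \<open>A\<close> exactly when the forward arc does not.\<close>

lemma place_ring_subset_iff:
  assumes A: "\<And>u v. u \<in> V \<Longrightarrow> v \<in> V \<Longrightarrow> u \<noteq> v \<Longrightarrow> (u, v) \<in> A \<longleftrightarrow> (v, u) \<notin> A"
    and n: "card V \<ge> 3" and xs: "xs \<in> permutations_of_set V"
  shows "place xs (oriented_ring (card V) w) \<subseteq> A \<longleftrightarrow> xs \<in> pattern_orderings A V w"
proof -
  have "(xs ! (Suc i mod card V), xs ! i) \<in> A \<longleftrightarrow> (xs ! i, xs ! (Suc i mod card V)) \<notin> A"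
    if i: "i < card V" for i
  proof (rule A)
    have "Suc i mod card V < card V" "Suc i mod card V \<noteq> i"
      using i n by (auto simp: mod_Suc)
    thus "xs ! (Suc i mod card V) \<in> V" "xs ! i \<in> V" "xs ! (Suc i mod card V) \<noteq> xs ! i"
      using i xs length_permutations_of_set[OF xs]
      by (auto simp: permutations_of_set_def nth_eq_iff_index_eq)
  qed
  thus ?thesis
    using xs by (auto simp: place_def oriented_ring_def pattern_orderings_def image_subset_iff
        simp del: if_image_distrib split: if_splits)
qed

text \<open>Passes from orderings to cycles: both counts of orderings are the same positive multiple
  \<open>K\<close> of the counts of cycles.\<close>

lemma card_placed_rings_not:
  assumes A: "\<And>u v. u \<in> V \<Longrightarrow> v \<in> V \<Longrightarrow> u \<noteq> v \<Longrightarrow> (u, v) \<in> A \<longleftrightarrow> (v, u) \<notin> A"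
    and n: "card V \<ge> 3"
  defines "placed \<equiv> \<lambda>w. (\<lambda>xs. place xs (oriented_ring (card V) w)) `
      {xs \<in> permutations_of_set V. place xs (oriented_ring (card V) w) \<subseteq> A}"
  shows "card (placed (\<lambda>i. \<not> w i)) = card (placed w)"
proof -
  define K where "K = card (ring_automorphisms (card V) (oriented_ring (card V) w))"
  have eq: "{xs \<in> permutations_of_set V. place xs (oriented_ring (card V) w) \<subseteq> A}
      = pattern_orderings A V w" for w
    using place_ring_subset_iff[OF A n] by (auto simp: pattern_orderings_def)
  have "K = card (ring_automorphisms (card V) (oriented_ring (card V) (\<lambda>i. \<not> w i)))"
    by (simp add: K_def oriented_ring_not ring_automorphisms_converse)
  hence "card (pattern_orderings A V (\<lambda>i. \<not> w i)) = K * card (placed (\<lambda>i. \<not> w i))"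
    using card_place_orderings[OF oriented_ring_subset, of V "\<lambda>i. \<not> w i" A]
    by (simp add: eq placed_def)
  moreover have "card (pattern_orderings A V w) = K * card (placed w)"
    using card_place_orderings[OF oriented_ring_subset, of V w A]
    by (simp add: eq placed_def K_def)
  moreover have "card (pattern_orderings A V (\<lambda>i. \<not> w i)) = card (pattern_orderings A V w)"
    using card_pattern_orderings_not[OF A] n by simp
  moreover have "K > 0"
  proof -
    have "id \<in> ring_automorphisms (card V) (oriented_ring (card V) w)"
      by (simp add: ring_automorphisms_def permutes_id prod.map_id0)
    moreover have "finite (ring_automorphisms (card V) (oriented_ring (card V) w))"
      by (rule finite_subset[OF _ finite_permutations[of "{..<card V}"]])
        (auto simp: ring_automorphisms_def)
    ultimately show ?thesis
      by (auto simp: K_def card_gt_0_iff)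
  qed
  ultimately show ?thesis by simp
qed

section \<open>Traversals and types\<close>

text \<open>Since each consecutive pair carries exactly one arc and there are no others, the vertex
  list and its directions determine the arc set.\<close>

lemma traversal_pattern_iff:
  assumes n: "length xs = n" "n \<ge> 3"
  shows "traversal C xs \<and> (\<forall>i<n. forward C xs i = w i) \<longleftrightarrow>
    distinct xs \<and> C = place xs (oriented_ring n w)" (is "?L \<longleftrightarrow> ?R")
proof
  assume L: ?L
  hence arcs: "(xs ! i, xs ! (Suc i mod n)) \<in> C \<longleftrightarrow> w i"
      "(xs ! (Suc i mod n), xs ! i) \<in> C \<longleftrightarrow> \<not> w i" if "i < n" for i
    using that n by (auto simp: traversal_def forward_def cyc_nth_def)
  have "C \<subseteq> (\<Union>i<n. {(xs ! i, xs ! (Suc i mod n)), (xs ! (Suc i mod n), xs ! i)})"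
    using L n by (auto simp: traversal_def cyc_nth_def)
  hence "C = (\<Union>i<n. if w i then {(xs ! i, xs ! (Suc i mod n))} else {(xs ! (Suc i mod n), xs ! i)})"
    (is "_ = ?U")
  proof (intro equalityI subsetI)
    fix e assume "e \<in> C"
    then obtain i where "i < n" "e = (xs ! i, xs ! (Suc i mod n)) \<or> e = (xs ! (Suc i mod n), xs ! i)"
      using \<open>C \<subseteq> _\<close> by blast
    thus "e \<in> ?U"
      using arcs[of i] \<open>e \<in> C\<close> by (intro UN_I[of i]) auto
  next
    fix e assume "e \<in> ?U"
    thus "e \<in> C"
      using arcs by (auto split: if_splits)
  qed
  also have "\<dots> = place xs (oriented_ring n w)"
    by (auto simp: place_def oriented_ring_def image_image split: if_splits)
  finally have "C = place xs (oriented_ring n w)" .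
  thus ?R
    using L by (simp add: traversal_def)
next
  assume R: ?R
  have arcs: "(xs ! i, xs ! (Suc i mod n)) \<in> C \<longleftrightarrow> w i"
      "(xs ! (Suc i mod n), xs ! i) \<in> C \<longleftrightarrow> \<not> w i" if "i < n" for i
    using that n R oriented_ring_subset[of n w]
    by (simp_all add: mem_place_iff mem_oriented_ring_iff)
  have "C \<subseteq> (\<Union>i<n. {(xs ! i, xs ! (Suc i mod n)), (xs ! (Suc i mod n), xs ! i)})"
    using R by (auto simp: place_def oriented_ring_def)
  thus ?L
    using R n arcs by (auto simp: traversal_def forward_def cyc_nth_def)
qed

lemma (in tournament) hamiltonian_cycles_eq_placed_rings:
  assumes n: "card (pverts T) \<ge> 3"
  shows "{C. oriented_cycle T C \<and> (\<exists>xs. traversal C xs \<and> length xs = card (pverts T) \<and>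
      (\<forall>i<card (pverts T). forward C xs i = w i))} =
    (\<lambda>xs. place xs (oriented_ring (card (pverts T)) w)) `
      {xs \<in> permutations_of_set (pverts T). place xs (oriented_ring (card (pverts T)) w) \<subseteq> parcs T}"
    (is "?L = ?R")
proof (intro equalityI subsetI)
  let ?n = "card (pverts T)"
  fix C assume "C \<in> ?L"
  then obtain xs where "C \<subseteq> parcs T" "length xs = ?n"
      "traversal C xs \<and> (\<forall>i<?n. forward C xs i = w i)"
    by (auto simp: oriented_cycle_def)
  hence xs: "C \<subseteq> parcs T" "length xs = ?n" "distinct xs" "C = place xs (oriented_ring ?n w)"
    using traversal_pattern_iff[OF _ n, of xs C w] by auto
  \<comment> \<open>Each listed vertex is an endpoint of an arc of \<open>C\<close>, hence a vertex
    of \<open>T\<close>; the length then forces \<open>xs\<close> to list all of them.\<close>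
  have "xs ! i \<in> pverts T" if "i < ?n" for i
  proof -
    have "(xs ! i, xs ! (Suc i mod ?n)) \<in> C \<or> (xs ! (Suc i mod ?n), xs ! i) \<in> C"
      using that xs(4) by (force simp: place_def oriented_ring_def)
    thus ?thesis
      using xs(1) in_arcsD1 in_arcsD2 by blast
  qed
  hence "set xs \<subseteq> pverts T"
    using xs(2) by (auto simp: in_set_conv_nth)
  hence "set xs = pverts T"
    using xs distinct_card[of xs] by (intro card_subset_eq pair_finite_verts) auto
  thus "C \<in> ?R"
    using xs by (auto simp: permutations_of_set_def)
next
  fix C assume "C \<in> ?R"
  then obtain xs where xs: "xs \<in> permutations_of_set (pverts T)"
      "C = place xs (oriented_ring (card (pverts T)) w)" "C \<subseteq> parcs T"
    by auto
  hence "traversal C xs \<and> (\<forall>i<card (pverts T). forward C xs i = w i)"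
    using traversal_pattern_iff[OF length_permutations_of_set[OF xs(1)] n, of C w]
    by (auto simp: permutations_of_set_def)
  thus "C \<in> ?L"
    using xs length_permutations_of_set[OF xs(1)] by (auto simp: oriented_cycle_def)
qed

text \<open>The block conditions of \<open>has_type\<close>, detached from any cycle so that the
  direction function \<open>f\<close> can be negated.\<close>

definition block_pattern :: "nat \<Rightarrow> (nat \<Rightarrow> bool) \<Rightarrow> int list \<Rightarrow> bool" where
  "block_pattern n f \<alpha> \<longleftrightarrow> (\<forall>i<length \<alpha>.
     let p = (\<Sum>j<i. nat \<bar>\<alpha> ! j\<bar>); l = nat \<bar>\<alpha> ! i\<bar>; d = (\<alpha> ! i > 0) in
     1 \<le> l \<and> l \<le> n \<and> (\<forall>k\<in>{p..<p + l}. f k = d) \<and> (l = n \<or> f (p + l) \<noteq> d \<and> f (p + n - 1) \<noteq> d))"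

lemma has_type_iff_block_pattern:
  "has_type C \<alpha> \<longleftrightarrow> (\<exists>xs. traversal C xs \<and> length xs = (\<Sum>a\<leftarrow>\<alpha>. nat \<bar>a\<bar>) \<and>
     block_pattern (\<Sum>a\<leftarrow>\<alpha>. nat \<bar>a\<bar>) (forward C xs) \<alpha>)"
proof -
  have "(\<forall>i<length \<alpha>. block C xs (\<Sum>j<i. nat \<bar>\<alpha> ! j\<bar>) (nat \<bar>\<alpha> ! i\<bar>) (\<alpha> ! i > 0))
      \<longleftrightarrow> block_pattern (length xs) (forward C xs) \<alpha>" for xs
    by (simp only: block_pattern_def block_def Let_def)
  thus ?thesis
    by (simp only: has_type_def cong: conj_cong)
qed

text \<open>Block positions and lengths see only absolute values, and negating a nonzero entry flips
  the required direction. A zero entry would keep it.\<close>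

lemma block_pattern_uminus:
  assumes "\<And>i. i < length \<alpha> \<Longrightarrow> \<alpha> ! i \<noteq> 0"
  shows "block_pattern n f (map uminus \<alpha>) \<longleftrightarrow> block_pattern n (\<lambda>i. \<not> f i) \<alpha>"
proof -
  have "(\<Sum>j<i. nat \<bar>map uminus \<alpha> ! j\<bar>) = (\<Sum>j<i. nat \<bar>\<alpha> ! j\<bar>)" if "i < length \<alpha>" for i
    using that by (intro sum.cong) auto
  moreover have "(map uminus \<alpha> ! i > 0) = (\<not> \<alpha> ! i > 0)" if "i < length \<alpha>" for i
    using that assms[OF that] by auto
  ultimately show ?thesis
    unfolding block_pattern_def Let_def by (simp cong: conj_cong) blast
qed

lemma partial_sum_interval_exists:
  fixes h :: "nat \<Rightarrow> nat"
  assumes "i < (\<Sum>j<m. h j)"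
  shows "\<exists>j<m. (\<Sum>k<j. h k) \<le> i \<and> i < (\<Sum>k<j. h k) + h j"
  using assms
proof (induction m)
  case (Suc m)
  show ?case
  proof (cases "i < (\<Sum>j<m. h j)")
    case True
    thus ?thesis using Suc.IH less_SucI by blast
  next
    case False
    thus ?thesis using Suc.prems by (intro exI[of _ m]) auto
  qed
qed simp

text \<open>The blocks cover all positions below the total length, and the sign of the covering
  entry fixes the direction there.\<close>

lemma block_pattern_unique:
  assumes f: "block_pattern n f \<alpha>" and g: "block_pattern n g \<alpha>" and i: "i < (\<Sum>a\<leftarrow>\<alpha>. nat \<bar>a\<bar>)"
  shows "f i = g i"
proof -
  have "(\<Sum>a\<leftarrow>\<alpha>. nat \<bar>a\<bar>) = (\<Sum>j<length \<alpha>. nat \<bar>\<alpha> ! j\<bar>)"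
    by (simp add: sum_list_sum_nth atLeast0LessThan)
  then obtain j where j: "j < length \<alpha>" "(\<Sum>k<j. nat \<bar>\<alpha> ! k\<bar>) \<le> i"
      "i < (\<Sum>k<j. nat \<bar>\<alpha> ! k\<bar>) + nat \<bar>\<alpha> ! j\<bar>"
    using partial_sum_interval_exists i by metis
  hence "f i = (\<alpha> ! j > 0)" "g i = (\<alpha> ! j > 0)"
    using f g by (auto simp: block_pattern_def Let_def)
  thus ?thesis by simp
qed

lemma forward_mod: "forward C xs (i mod length xs) = forward C xs i"
  by (simp add: forward_def cyc_nth_def mod_simps)

text \<open>One witness \<open>w\<close> turns the type into a fixed pattern. Periodicity is
  required because the maximality conditions look at positions beyond the first round.\<close>

lemma has_type_iff_pattern:
  assumes w: "block_pattern (\<Sum>a\<leftarrow>\<alpha>. nat \<bar>a\<bar>) w \<alpha>"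
    and periodic: "\<And>i. w (i mod (\<Sum>a\<leftarrow>\<alpha>. nat \<bar>a\<bar>)) = w i"
  shows "has_type C \<alpha> \<longleftrightarrow> (\<exists>xs. traversal C xs \<and> length xs = (\<Sum>a\<leftarrow>\<alpha>. nat \<bar>a\<bar>) \<and>
     (\<forall>i<(\<Sum>a\<leftarrow>\<alpha>. nat \<bar>a\<bar>). forward C xs i = w i))"
proof -
  define n where "n = (\<Sum>a\<leftarrow>\<alpha>. nat \<bar>a\<bar>)"
  have "block_pattern n (forward C xs) \<alpha> \<longleftrightarrow> (\<forall>i<n. forward C xs i = w i)"
    if "traversal C xs" "length xs = n" for xs
  proof
    assume "block_pattern n (forward C xs) \<alpha>"
    thus "\<forall>i<n. forward C xs i = w i"
      using block_pattern_unique w by (auto simp: n_def)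
  next
    assume *: "\<forall>i<n. forward C xs i = w i"
    have "n > 0"
      using that by (auto simp: traversal_def)
    have "forward C xs i = w i" for i
      using * forward_mod[of C xs i] periodic[of i] that(2) \<open>n > 0\<close> by (simp add: n_def)
    hence "forward C xs = w" ..
    thus "block_pattern n (forward C xs) \<alpha>"
      using w by (simp add: n_def)
  qed
  thus ?thesis
    unfolding has_type_iff_block_pattern n_def[symmetric] by blast
qed

theorem theorem19:
  fixes T :: "'a pair_pre_digraph" and \<alpha> :: "int list"
  assumes "tournament T"
    and "\<alpha> \<noteq> []"
    and "\<And>i. Suc i < length \<alpha> \<Longrightarrow> \<alpha> ! i * \<alpha> ! Suc i < 0"
    and "\<alpha> ! 0 \<ge> 0"
    and "length \<alpha> \<noteq> 1 \<Longrightarrow> even (length \<alpha>)"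
    and "card (pverts T) = (\<Sum>a\<leftarrow>\<alpha>. nat \<bar>a\<bar>)"
  shows "num_cycles T \<alpha> = num_cycles T (map uminus \<alpha>)"
proof -
  interpret tournament T by fact
  define n where "n = (\<Sum>a\<leftarrow>\<alpha>. nat \<bar>a\<bar>)"
  have card: "card (pverts T) = n"
    using assms(6) by (simp add: n_def)
  have neg: "(\<Sum>a\<leftarrow>map uminus \<alpha>. nat \<bar>a\<bar>) = n"
    by (simp add: n_def comp_def)
  show ?thesis
  \<comment> \<open>Either some periodic direction function realises \<open>\<alpha>\<close>, and
    the pattern count applies, or both sides are 0.\<close>
  proof (cases "n \<ge> 3 \<and> (\<exists>w. block_pattern n w \<alpha> \<and> (\<forall>i. w (i mod n) = w i))")
    case True
    then obtain w where n: "n \<ge> 3" and w: "block_pattern n w \<alpha>" "\<And>i. w (i mod n) = w i"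
      by blast
    have nz: "\<alpha> ! i \<noteq> 0" if "i < length \<alpha>" for i
      using w(1) that by (fastforce simp: block_pattern_def Let_def)
    define \<C> where "\<C> v = {C. oriented_cycle T C \<and> (\<exists>xs. traversal C xs \<and> length xs = n \<and>
      (\<forall>i<n. forward C xs i = v i))}" for v
    have "num_cycles T \<alpha> = card (\<C> w)"
      by (simp only: num_cycles_def \<C>_def has_type_iff_pattern[of \<alpha> w, folded n_def, OF w])
    moreover have "num_cycles T (map uminus \<alpha>) = card (\<C> (\<lambda>i. \<not> w i))"
    proof -
      have pattern: "block_pattern n (\<lambda>i. \<not> w i) (map uminus \<alpha>)"
        using w(1) by (simp add: block_pattern_uminus[OF nz])
      have periodic: "(\<not> w (i mod n)) = (\<not> w i)" for i
        using w(2) by simp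
      show ?thesis
        by (simp only: num_cycles_def \<C>_def
            has_type_iff_pattern[of "map uminus \<alpha>" "\<lambda>i. \<not> w i", unfolded neg, OF pattern periodic])
    qed
    moreover have "card (\<C> (\<lambda>i. \<not> w i)) = card (\<C> w)"
      unfolding \<C>_def hamiltonian_cycles_eq_placed_rings[unfolded card, OF n]
      by (rule card_placed_rings_not[of "pverts T" "parcs T" w, unfolded card, OF exactly_one_arc n])
    ultimately show ?thesis by simp
  next
    case False
    \<comment> \<open>The directions along a cycle of type \<open>\<alpha>\<close>, or their
      negation for a cycle of the negated type, would give the excluded \<open>w\<close>.\<close>
    have pat: "n \<ge> 3 \<and> (\<forall>i. f (i mod n) = f i)"
      if "traversal C xs" "length xs = n" "f = forward C xs" for C :: "'a rel" and xs f
      using that forward_mod[of C xs] by (auto simp: traversal_def)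
    have "\<not> has_type C \<alpha>" for C :: "'a rel"
      using False pat unfolding has_type_iff_block_pattern n_def[symmetric] by blast
    moreover have "\<not> has_type C (map uminus \<alpha>)" for C :: "'a rel"
    proof
      assume "has_type C (map uminus \<alpha>)"
      then obtain xs where xs: "traversal C xs" "length xs = n"
          "block_pattern n (forward C xs) (map uminus \<alpha>)"
        unfolding has_type_iff_block_pattern neg by blast
      have "\<alpha> ! i \<noteq> 0" if "i < length \<alpha>" for i
        using xs(3) that by (fastforce simp: block_pattern_def Let_def)
      hence "block_pattern n (\<lambda>i. \<not> forward C xs i) \<alpha>"
        using xs(3) block_pattern_uminus by blast
      thus False
        using False pat[OF xs(1,2) refl] by blast
    qed
    ultimately show ?thesis
      by (simp add: num_cycles_def)
  qed
qed

end
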